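(* Let $T$ be a finite, medial, connected quandle. Then $\mathrm{Hom}(S,T)$ is connected for every quandle $S$.
   Context: A quandle is a set $Q$ with a binary operation $\triangleright$ such that $x\triangleright x=x$; for all $y,z$ there is a unique $x$ with $y\triangleright x=z$; and $x\triangleright(y\triangleright z)=(x\triangleright y)\triangleright(x\triangleright z)$. It is medial if $(x\triangleright y)\triangleright(z\triangleright w)=(x\triangleright z)\triangleright(y\triangleright w)$ for all $x,y,z,w$. The components of $Q$ are the orbits of the group generated by the bijections $L_a:x\mapsto a\triangleright x$; $Q$ is connected if it has only one component. For $T$ medial, $\mathrm{Hom}(S,T)$, the set of quandle homomorphisms, is a (medial) quandle under the pointwise operation $(h\triangleright k)(a)=h(a)\triangleright k(a)$ (known). *)

theory Defs
  imports "HOL-Algebra.Bij" "HOL-Algebra.Generated_Groups" "HOL-Algebra.Group_Action"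
begin

record 'a quandle_struct = "'a partial_object" +
  qop :: "'a \<Rightarrow> 'a \<Rightarrow> 'a" (infixl \<open>\<triangleright>\<index>\<close> 70)

locale quandle =
  fixes Q (structure)
  assumes closed [intro, simp]:
      "\<lbrakk>x \<in> carrier Q; y \<in> carrier Q\<rbrakk> \<Longrightarrow> x \<triangleright> y \<in> carrier Q"
    and idem: "x \<in> carrier Q \<Longrightarrow> x \<triangleright> x = x"
    and left_div:
      "\<lbrakk>y \<in> carrier Q; z \<in> carrier Q\<rbrakk> \<Longrightarrow> \<exists>!x. x \<in> carrier Q \<and> y \<triangleright> x = z"
    and left_distrib:
      "\<lbrakk>x \<in> carrier Q; y \<in> carrier Q; z \<in> carrier Q\<rbrakk>
        \<Longrightarrow> x \<triangleright> (y \<triangleright> z) = (x \<triangleright> y) \<triangleright> (x \<triangleright> z)"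

locale medial_quandle = quandle +
  assumes medial:
    "\<lbrakk>x \<in> carrier Q; y \<in> carrier Q; z \<in> carrier Q; w \<in> carrier Q\<rbrakk>
      \<Longrightarrow> (x \<triangleright> y) \<triangleright> (z \<triangleright> w) = (x \<triangleright> z) \<triangleright> (y \<triangleright> w)"

definition left_mult :: "('a, 'm) quandle_struct_scheme \<Rightarrow> 'a \<Rightarrow> 'a \<Rightarrow> 'a"
  where "left_mult Q a = (\<lambda>x\<in>carrier Q. a \<triangleright>\<^bsub>Q\<^esub> x)"

definition left_mult_group :: "('a, 'm) quandle_struct_scheme \<Rightarrow> ('a \<Rightarrow> 'a) monoid"
  where "left_mult_group Q =
    (BijGroup (carrier Q))
      \<lparr>carrier := generate (BijGroup (carrier Q)) (left_mult Q ` carrier Q)\<rparr>"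

definition components :: "('a, 'm) quandle_struct_scheme \<Rightarrow> 'a set set"
  where "components Q = orbits (left_mult_group Q) (carrier Q) (\<lambda>g. g)"

text \<open>
  There is exactly one component; in particular the empty quandle, which has none,
  does not count as connected.
\<close>

definition connected_quandle :: "('a, 'm) quandle_struct_scheme \<Rightarrow> bool"
  where "connected_quandle Q \<longleftrightarrow> quandle Q \<and> (\<exists>C. components Q = {C})"

text \<open>
  Homomorphisms are taken to be extensional, i.e. \<open>undefined\<close> outside the carrier of
  the source, so that equality of homomorphisms is equality of their values on that carrier.
\<close>

definition quandle_hom ::
    "('a, 'm) quandle_struct_scheme \<Rightarrow> ('b, 'n) quandle_struct_scheme \<Rightarrow> ('a \<Rightarrow> 'b) set"
  where "quandle_hom S T =
    {h \<in> carrier S \<rightarrow>\<^sub>E carrier T.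
      \<forall>x\<in>carrier S. \<forall>y\<in>carrier S. h (x \<triangleright>\<^bsub>S\<^esub> y) = h x \<triangleright>\<^bsub>T\<^esub> h y}"

definition Hom ::
    "('a, 'm) quandle_struct_scheme \<Rightarrow> ('b, 'n) quandle_struct_scheme \<Rightarrow> ('a \<Rightarrow> 'b) quandle_struct"
  where "Hom S T =
    \<lparr>carrier = quandle_hom S T, qop = (\<lambda>h k. \<lambda>a\<in>carrier S. h a \<triangleright>\<^bsub>T\<^esub> k a)\<rparr>"

lemma (in quandle) left_mult_Bij:
  assumes "a \<in> carrier Q"
  shows "left_mult Q a \<in> Bij (carrier Q)"
proof -
  have "bij_betw (left_mult Q a) (carrier Q) (carrier Q)"
    unfolding bij_betw_def
  proof
    show "inj_on (left_mult Q a) (carrier Q)"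
    proof (rule inj_onI)
      fix x y assume xy: "x \<in> carrier Q" "y \<in> carrier Q" "left_mult Q a x = left_mult Q a y"
      then have "a \<triangleright> x = a \<triangleright> y" by (simp add: left_mult_def)
      then show "x = y" using left_div[OF assms closed[OF assms xy(2)]] xy by blast
    qed
    show "left_mult Q a ` carrier Q = carrier Q"
    proof
      show "left_mult Q a ` carrier Q \<subseteq> carrier Q"
        using assms by (auto simp: left_mult_def)
      show "carrier Q \<subseteq> left_mult Q a ` carrier Q"
      proof
        fix z assume "z \<in> carrier Q"
        then obtain x where "x \<in> carrier Q" "a \<triangleright> x = z" using left_div[OF assms] by blast
        then show "z \<in> left_mult Q a ` carrier Q"
          by (auto simp: left_mult_def image_iff)
      qed
    qed
  qed
  then show ?thesis by (simp add: Bij_def left_mult_def)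
qed

lemma quandle_Hom:
  assumes S: "quandle S" and T: "medial_quandle T"
  shows "quandle (Hom S T)"
proof -
  interpret S: quandle S by (rule S)
  interpret T: medial_quandle T by (rule T)
  have val: "h a \<in> carrier T" if "h \<in> quandle_hom S T" "a \<in> carrier S" for h a
    using that by (auto simp: quandle_hom_def)
  have hom: "h (x \<triangleright>\<^bsub>S\<^esub> y) = h x \<triangleright>\<^bsub>T\<^esub> h y"
    if "h \<in> quandle_hom S T" "x \<in> carrier S" "y \<in> carrier S" for h x y
    using that by (simp add: quandle_hom_def)
  have ext: "h = k"
    if "h \<in> quandle_hom S T" "k \<in> quandle_hom S T" "\<And>a. a \<in> carrier S \<Longrightarrow> h a = k a" for h k
    using that by (auto simp: quandle_hom_def intro: PiE_ext)
  have cl: "(\<lambda>a\<in>carrier S. h a \<triangleright>\<^bsub>T\<^esub> k a) \<in> quandle_hom S T"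
    if hk: "h \<in> quandle_hom S T" "k \<in> quandle_hom S T" for h k
  proof -
    have "(h x \<triangleright>\<^bsub>T\<^esub> h y) \<triangleright>\<^bsub>T\<^esub> (k x \<triangleright>\<^bsub>T\<^esub> k y)
        = (h x \<triangleright>\<^bsub>T\<^esub> k x) \<triangleright>\<^bsub>T\<^esub> (h y \<triangleright>\<^bsub>T\<^esub> k y)"
      if "x \<in> carrier S" "y \<in> carrier S" for x y
      using T.medial val hk that by blast
    then show ?thesis
      unfolding quandle_hom_def using hk val by (simp add: hom)
  qed
  have cancel: "u = v"
    if "y \<in> carrier T" "u \<in> carrier T" "v \<in> carrier T" "y \<triangleright>\<^bsub>T\<^esub> u = y \<triangleright>\<^bsub>T\<^esub> v" for y u v
    using that T.left_div[of y "y \<triangleright>\<^bsub>T\<^esub> v"] by blast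
  have div: "\<exists>!x. x \<in> quandle_hom S T \<and> (\<lambda>a\<in>carrier S. h a \<triangleright>\<^bsub>T\<^esub> x a) = k"
    if hk: "h \<in> quandle_hom S T" "k \<in> quandle_hom S T" for h k
  proof (rule ex_ex1I)
    have "\<exists>u. u \<in> carrier T \<and> h a \<triangleright>\<^bsub>T\<^esub> u = k a" if "a \<in> carrier S" for a
      using T.left_div[OF val[OF hk(1) that] val[OF hk(2) that]] by blast
    then obtain f where f: "f a \<in> carrier T" "h a \<triangleright>\<^bsub>T\<^esub> f a = k a" if "a \<in> carrier S" for a
      by metis
    have "f (x \<triangleright>\<^bsub>S\<^esub> y) = f x \<triangleright>\<^bsub>T\<^esub> f y" if xy: "x \<in> carrier S" "y \<in> carrier S" for x y
    proof (rule cancel[of "h (x \<triangleright>\<^bsub>S\<^esub> y)"])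
      have "h (x \<triangleright>\<^bsub>S\<^esub> y) \<triangleright>\<^bsub>T\<^esub> (f x \<triangleright>\<^bsub>T\<^esub> f y)
          = (h x \<triangleright>\<^bsub>T\<^esub> f x) \<triangleright>\<^bsub>T\<^esub> (h y \<triangleright>\<^bsub>T\<^esub> f y)"
        using T.medial[of "h x" "h y" "f x" "f y"] xy hk f val by (simp only: hom)
      also have "\<dots> = k (x \<triangleright>\<^bsub>S\<^esub> y)" using xy hk f by (simp add: hom)
      finally show "h (x \<triangleright>\<^bsub>S\<^esub> y) \<triangleright>\<^bsub>T\<^esub> f (x \<triangleright>\<^bsub>S\<^esub> y)
          = h (x \<triangleright>\<^bsub>S\<^esub> y) \<triangleright>\<^bsub>T\<^esub> (f x \<triangleright>\<^bsub>T\<^esub> f y)"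
        using xy f by simp
    qed (use xy hk f val in auto)
    then have "restrict f (carrier S) \<in> quandle_hom S T"
      using f by (simp add: quandle_hom_def)
    moreover have "(\<lambda>a\<in>carrier S. h a \<triangleright>\<^bsub>T\<^esub> restrict f (carrier S) a) = k"
      by (rule ext[OF cl[OF hk(1) calculation] hk(2)]) (simp add: f)
    ultimately show "\<exists>x. x \<in> quandle_hom S T \<and> (\<lambda>a\<in>carrier S. h a \<triangleright>\<^bsub>T\<^esub> x a) = k"
      by blast
  next
    fix u v
    assume u: "u \<in> quandle_hom S T \<and> (\<lambda>a\<in>carrier S. h a \<triangleright>\<^bsub>T\<^esub> u a) = k"
      and v: "v \<in> quandle_hom S T \<and> (\<lambda>a\<in>carrier S. h a \<triangleright>\<^bsub>T\<^esub> v a) = k"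
    show "u = v"
    proof (rule ext)
      fix a assume a: "a \<in> carrier S"
      have "h a \<triangleright>\<^bsub>T\<^esub> u a = h a \<triangleright>\<^bsub>T\<^esub> v a"
        using u v a by (auto dest: fun_cong[of _ _ a])
      then show "u a = v a" using cancel[of "h a" "u a" "v a"] val hk u v a by blast
    qed (use u v in auto)
  qed
  show ?thesis
  proof (unfold_locales, goal_cases)
    case (1 h k) then show ?case by (simp add: Hom_def cl)
  next
    case (2 h)
    then have h: "h \<in> quandle_hom S T" by (simp add: Hom_def)
    show ?case unfolding Hom_def
      by (simp, rule ext[OF cl[OF h h] h]) (simp add: T.idem val[OF h])
  next
    case (3 h k) then show ?case using div by (simp add: Hom_def)
  next
    case (4 h k l)
    then have hkl: "h \<in> quandle_hom S T" "k \<in> quandle_hom S T" "l \<in> quandle_hom S T"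
      by (simp_all add: Hom_def)
    have "h a \<triangleright>\<^bsub>T\<^esub> (k a \<triangleright>\<^bsub>T\<^esub> l a)
        = (h a \<triangleright>\<^bsub>T\<^esub> k a) \<triangleright>\<^bsub>T\<^esub> (h a \<triangleright>\<^bsub>T\<^esub> l a)"
      if "a \<in> carrier S" for a
      using T.left_distrib val hkl that by blast
    then show ?case by (auto simp: Hom_def intro!: restrict_ext)
  qed
qed

end

theory Submission
  imports Defs
begin

text \<open>
  A finite connected medial quandle is Latin: every right translation \<open>x \<mapsto> x \<triangleright> e\<close> is a
  bijection. Indeed, in a finite connected quandle a nonempty subset closed under all left
  translations is everything. By mediality, this applies first to the set of all \<open>x\<close> such that
  \<open>p \<triangleright> (x \<triangleright> e)\<close> lies in the image of the right translation by \<open>e\<close> for every \<open>p\<close>, and then to that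
  image itself. Given homomorphisms \<open>h\<close> and \<open>k\<close> into a Latin medial quandle, the pointwise solution
  \<open>f\<close> of \<open>f \<triangleright> h = k\<close> is again a homomorphism, so a single left translation of \<open>Hom S T\<close> moves \<open>h\<close>
  to \<open>k\<close>.
\<close>

text \<open>\<open>quandle\<close> already contains unique left division; adding unique right
  division makes the multiplication table a Latin square.\<close>

definition latin_quandle :: "('a, 'm) quandle_struct_scheme \<Rightarrow> bool"
  where "latin_quandle Q \<longleftrightarrow> quandle Q \<and>
    (\<forall>y\<in>carrier Q. \<forall>z\<in>carrier Q. \<exists>!x. x \<in> carrier Q \<and> x \<triangleright>\<^bsub>Q\<^esub> y = z)"

context quandle
begin

lemma generate_left_mult_subset_Bij:
  "generate (BijGroup (carrier Q)) (left_mult Q ` carrier Q) \<subseteq> Bij (carrier Q)"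
  using group.generate_incl[OF group_BijGroup, of "left_mult Q ` carrier Q" "carrier Q"]
    left_mult_Bij by (auto simp: BijGroup_def)

text \<open>Inverses of generators are the delicate case: an injective map of the finite set
  \<open>C\<close> into itself is onto \<open>C\<close>, so its inverse preserves \<open>C\<close>
  as well.\<close>

lemma finite_left_closed_generate_closed:
  assumes C: "C \<subseteq> carrier Q" "finite C"
    and closed_C: "\<And>a x. \<lbrakk>a \<in> carrier Q; x \<in> C\<rbrakk> \<Longrightarrow> a \<triangleright> x \<in> C"
    and g: "g \<in> generate (BijGroup (carrier Q)) (left_mult Q ` carrier Q)"
    and x: "x \<in> C"
  shows "g x \<in> C"
  using g x
proof (induction arbitrary: x rule: generate.induct)
  case one
  then show ?case using C by (auto simp: BijGroup_def)
next
  case (incl g)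
  then show ?case using C closed_C by (auto simp: left_mult_def)
next
  case (inv g)
  then obtain a where a: "a \<in> carrier Q" "g = left_mult Q a" by blast
  have bij: "g \<in> Bij (carrier Q)" using left_mult_Bij a by simp
  then have inj: "inj_on g (carrier Q)" by (simp add: Bij_def bij_betw_def)
  have "g ` C \<subseteq> C" using a C closed_C by (auto simp: left_mult_def)
  then have "g ` C = C"
    using endo_inj_surj[OF C(2)] inj_on_subset[OF inj C(1)] by simp
  then obtain y where y: "y \<in> C" "g y = x" using inv.prems by (metis imageE)
  then have "inv_into (carrier Q) g x = y" using inv_into_f_f[OF inj, of y] C by auto
  then show ?case
    using y(1) inv.prems C bij by (auto simp: inv_BijGroup)
next
  case (eng g h)
  then have "g \<in> Bij (carrier Q)" "h \<in> Bij (carrier Q)"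
    using generate_left_mult_subset_Bij by auto
  then show ?case using eng C by (auto simp: BijGroup_def compose_def)
qed

lemma orbit_left_mult_group_self:
  assumes "x \<in> carrier Q"
  shows "x \<in> orbit (left_mult_group Q) (\<lambda>g. g) x"
proof -
  have "\<one>\<^bsub>BijGroup (carrier Q)\<^esub> x = x" using assms by (simp add: BijGroup_def)
  moreover have "\<one>\<^bsub>BijGroup (carrier Q)\<^esub> \<in> carrier (left_mult_group Q)"
    by (simp add: left_mult_group_def generate.one)
  ultimately show ?thesis unfolding orbit_def by (metis (mono_tags, lifting) mem_Collect_eq)
qed

text \<open>\<open>C\<close> contains the whole orbit of each of its points, and connectedness
  leaves only one orbit.\<close>

lemma connected_left_closed_eq_carrier:
  assumes conn: "connected_quandle Q" and fin: "finite (carrier Q)"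
    and C: "C \<subseteq> carrier Q" "C \<noteq> {}"
    and closed_C: "\<And>a x. \<lbrakk>a \<in> carrier Q; x \<in> C\<rbrakk> \<Longrightarrow> a \<triangleright> x \<in> C"
  shows "C = carrier Q"
proof
  show "carrier Q \<subseteq> C"
  proof
    fix z assume z: "z \<in> carrier Q"
    obtain e where e: "e \<in> C" using C by blast
    have "orbit (left_mult_group Q) (\<lambda>g. g) y \<in> components Q" if "y \<in> carrier Q" for y
      using that by (auto simp: components_def orbits_def)
    then have "orbit (left_mult_group Q) (\<lambda>g. g) z = orbit (left_mult_group Q) (\<lambda>g. g) e"
      using conn z e C unfolding connected_quandle_def by (metis singletonD subsetD)
    then have "z \<in> orbit (left_mult_group Q) (\<lambda>g. g) e"
      using orbit_left_mult_group_self[OF z] by simp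
    then show "z \<in> C"
      using finite_left_closed_generate_closed[OF C(1) finite_subset[OF C(1) fin] closed_C _ e]
      by (auto simp: orbit_def left_mult_group_def)
  qed
qed (rule C)

text \<open>The generators alone already join any two points, so every orbit is the whole carrier.
  Nonemptiness ensures that there is an orbit at all.\<close>

lemma left_transitive_imp_connected:
  assumes ne: "carrier Q \<noteq> {}"
    and trans: "\<And>y z. \<lbrakk>y \<in> carrier Q; z \<in> carrier Q\<rbrakk> \<Longrightarrow> \<exists>x\<in>carrier Q. x \<triangleright> y = z"
  shows "connected_quandle Q"
proof -
  have "orbit (left_mult_group Q) (\<lambda>g. g) y = carrier Q" if y: "y \<in> carrier Q" for y
  proof
    show "orbit (left_mult_group Q) (\<lambda>g. g) y \<subseteq> carrier Q"
    proof
      fix z assume "z \<in> orbit (left_mult_group Q) (\<lambda>g. g) y"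
      then obtain g where "g \<in> Bij (carrier Q)" "z = g y"
        using generate_left_mult_subset_Bij by (auto simp: orbit_def left_mult_group_def)
      then show "z \<in> carrier Q" using y by (auto simp: Bij_def bij_betw_def)
    qed
    show "carrier Q \<subseteq> orbit (left_mult_group Q) (\<lambda>g. g) y"
    proof
      fix z assume "z \<in> carrier Q"
      then obtain x where x: "x \<in> carrier Q" "x \<triangleright> y = z" using trans y by blast
      then have "left_mult Q x y = z" using y by (simp add: left_mult_def)
      moreover have "left_mult Q x \<in> carrier (left_mult_group Q)"
        using x by (simp add: left_mult_group_def generate.incl)
      ultimately show "z \<in> orbit (left_mult_group Q) (\<lambda>g. g) y"
        unfolding orbit_def by blast
    qed
  qed
  then have "components Q = {carrier Q}" using ne by (auto simp: components_def orbits_def)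
  then show ?thesis using quandle_axioms by (auto simp: connected_quandle_def)
qed

end

theorem (in medial_quandle) finite_connected_imp_latin:
  assumes fin: "finite (carrier Q)" and conn: "connected_quandle Q"
  shows "latin_quandle Q"
proof -
  have surj: "(\<lambda>x. x \<triangleright> e) ` carrier Q = carrier Q" if e: "e \<in> carrier Q" for e
  proof -
    define I where "I = (\<lambda>x. x \<triangleright> e) ` carrier Q"
    have e_I: "e \<in> I" using e idem[OF e] by (force simp: I_def)
    \<comment> \<open>In the affine case \<open>x \<triangleright> y = (1 - t) x + t y\<close> the preimage found here is \<open>p + t (1 - t) (a - e)\<close>.\<close>
    have base: "p \<triangleright> ((a \<triangleright> e) \<triangleright> e) \<in> I" if a: "a \<in> carrier Q" and p: "p \<in> carrier Q" for a p
    proof -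
      \<comment> \<open>Writing \<open>p\<close> as a product with left factor \<open>e\<close>
        gives the expression the four-factor shape to which mediality applies.\<close>
      obtain q where q: "q \<in> carrier Q" "e \<triangleright> q = p" using left_div[OF e p] by blast
      have "(e \<triangleright> q) \<triangleright> ((a \<triangleright> e) \<triangleright> e) = (e \<triangleright> (a \<triangleright> e)) \<triangleright> (q \<triangleright> e)"
        using medial a e q by simp
      also have "\<dots> = ((e \<triangleright> a) \<triangleright> e) \<triangleright> (q \<triangleright> e)"
        using left_distrib[of e a e] idem[OF e] a e by simp
      also have "\<dots> = ((e \<triangleright> a) \<triangleright> q) \<triangleright> e"
        using medial[of "e \<triangleright> a" q e e] idem[OF e] a e q by simp
      finally show ?thesis using a e q by (auto simp: I_def)
    qed
    define C where "C = {x \<in> carrier Q. \<forall>p\<in>carrier Q. p \<triangleright> (x \<triangleright> e) \<in> I}"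
    have "C = carrier Q"
    proof (rule connected_left_closed_eq_carrier[OF conn fin])
      show "C \<subseteq> carrier Q" by (auto simp: C_def)
      have "e \<in> C" using e by (simp add: C_def I_def idem)
      then show "C \<noteq> {}" by blast
      fix a x assume a: "a \<in> carrier Q" and "x \<in> C"
      then have x: "x \<in> carrier Q" "\<And>p. p \<in> carrier Q \<Longrightarrow> p \<triangleright> (x \<triangleright> e) \<in> I"
        by (auto simp: C_def)
      have "p \<triangleright> ((a \<triangleright> x) \<triangleright> e) \<in> I" if p: "p \<in> carrier Q" for p
      proof -
        obtain q where q: "q \<in> carrier Q" "e \<triangleright> q = p" using left_div[OF e p] by blast
        \<comment> \<open>The assumption on \<open>x\<close> is used at \<open>q\<close> instead of
          \<open>p\<close>; this is why membership in \<open>C\<close> quantifies over all left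
          factors.\<close>
        obtain u where u: "u \<in> carrier Q" "q \<triangleright> (x \<triangleright> e) = u \<triangleright> e"
          using x(2)[OF q(1)] by (auto simp: I_def)
        have "p \<triangleright> ((a \<triangleright> x) \<triangleright> e) = (e \<triangleright> q) \<triangleright> ((a \<triangleright> e) \<triangleright> (x \<triangleright> e))"
          using medial[of a x e e] idem[OF e] a e x q by simp
        also have "\<dots> = (e \<triangleright> (a \<triangleright> e)) \<triangleright> (u \<triangleright> e)"
          using medial[of e q "a \<triangleright> e" "x \<triangleright> e"] a e x q u by simp
        \<comment> \<open>This has the form treated in \<open>base\<close>, with
          \<open>e \<triangleright> u\<close> as left factor.\<close>
        also have "\<dots> = (e \<triangleright> u) \<triangleright> ((a \<triangleright> e) \<triangleright> e)"
          using medial[of e "a \<triangleright> e" u e] a e u by simp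
        finally show ?thesis using base a e u by simp
      qed
      then show "a \<triangleright> x \<in> C" using a x by (simp add: C_def)
    qed
    \<comment> \<open>That every \<open>x\<close> lies in \<open>C\<close> means precisely that
      \<open>I\<close> is closed under all left translations.\<close>
    then have "I = carrier Q"
      using e e_I by (intro connected_left_closed_eq_carrier[OF conn fin]) (auto simp: I_def C_def)
    then show ?thesis by (simp add: I_def)
  qed
  have "\<exists>!x. x \<in> carrier Q \<and> x \<triangleright> y = z" if yz: "y \<in> carrier Q" "z \<in> carrier Q" for y z
  proof -
    \<comment> \<open>A surjective self-map of a finite set is injective.\<close>
    have "inj_on (\<lambda>x. x \<triangleright> y) (carrier Q)"
      by (rule eq_card_imp_inj_on[OF fin]) (simp add: surj[OF yz(1)])
    moreover obtain x where "x \<in> carrier Q" "x \<triangleright> y = z" using surj[OF yz(1)] yz(2) by force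
    ultimately show ?thesis by (auto dest: inj_onD)
  qed
  then show ?thesis using quandle_axioms by (simp add: latin_quandle_def)
qed

text \<open>Divide pointwise in \<open>T\<close>. By mediality
  \<open>f x \<triangleright> f y\<close> solves the equation that defines \<open>f\<close> at the
  product of \<open>x\<close> and \<open>y\<close>, so right cancellation makes \<open>f\<close> a
  homomorphism.\<close>

lemma Hom_right_div:
  assumes S: "quandle S" and T: "medial_quandle T" "latin_quandle T"
    and h: "h \<in> quandle_hom S T" and k: "k \<in> quandle_hom S T"
  shows "\<exists>f\<in>quandle_hom S T. f \<triangleright>\<^bsub>Hom S T\<^esub> h = k"
proof -
  interpret S: quandle S by (rule S)
  interpret T: medial_quandle T by (rule T)
  have latin: "\<exists>!x. x \<in> carrier T \<and> x \<triangleright>\<^bsub>T\<^esub> y = z" if "y \<in> carrier T" "z \<in> carrier T" for y z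
    using T(2) that by (simp add: latin_quandle_def)
  have cancel: "u = v"
    if "y \<in> carrier T" "u \<in> carrier T" "v \<in> carrier T" "u \<triangleright>\<^bsub>T\<^esub> y = v \<triangleright>\<^bsub>T\<^esub> y" for y u v
    using that latin[of y "v \<triangleright>\<^bsub>T\<^esub> y"] by blast
  have val: "h a \<in> carrier T" "k a \<in> carrier T" if "a \<in> carrier S" for a
    using h k that by (auto simp: quandle_hom_def)
  have hom: "h (x \<triangleright>\<^bsub>S\<^esub> y) = h x \<triangleright>\<^bsub>T\<^esub> h y" "k (x \<triangleright>\<^bsub>S\<^esub> y) = k x \<triangleright>\<^bsub>T\<^esub> k y"
    if "x \<in> carrier S" "y \<in> carrier S" for x y
    using h k that unfolding quandle_hom_def by blast+
  have "\<exists>u. u \<in> carrier T \<and> u \<triangleright>\<^bsub>T\<^esub> h a = k a" if "a \<in> carrier S" for a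
    by (rule ex1_implies_ex[OF latin[OF val[OF that]]])
  then obtain f where f: "f a \<in> carrier T" "f a \<triangleright>\<^bsub>T\<^esub> h a = k a" if "a \<in> carrier S" for a
    by metis
  have "f (x \<triangleright>\<^bsub>S\<^esub> y) = f x \<triangleright>\<^bsub>T\<^esub> f y" if xy: "x \<in> carrier S" "y \<in> carrier S" for x y
  proof -
    have "(f x \<triangleright>\<^bsub>T\<^esub> f y) \<triangleright>\<^bsub>T\<^esub> h (x \<triangleright>\<^bsub>S\<^esub> y)
        = (f x \<triangleright>\<^bsub>T\<^esub> h x) \<triangleright>\<^bsub>T\<^esub> (f y \<triangleright>\<^bsub>T\<^esub> h y)"
      using T.medial[of "f x" "f y" "h x" "h y"] xy f val by (simp only: hom)
    also have "\<dots> = k (x \<triangleright>\<^bsub>S\<^esub> y)" using xy f by (simp add: hom)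
    also have "\<dots> = f (x \<triangleright>\<^bsub>S\<^esub> y) \<triangleright>\<^bsub>T\<^esub> h (x \<triangleright>\<^bsub>S\<^esub> y)" using xy f by simp
    finally show ?thesis using cancel[of "h (x \<triangleright>\<^bsub>S\<^esub> y)"] xy f val by simp
  qed
  then have "restrict f (carrier S) \<in> quandle_hom S T"
    using f by (simp add: quandle_hom_def)
  moreover have "restrict f (carrier S) \<triangleright>\<^bsub>Hom S T\<^esub> h = k"
  proof
    fix a
    show "(restrict f (carrier S) \<triangleright>\<^bsub>Hom S T\<^esub> h) a = k a"
    proof (cases "a \<in> carrier S")
      case True
      then show ?thesis by (simp add: Hom_def f)
    next
      case False
      \<comment> \<open>Off the carrier of \<open>S\<close> both sides are \<open>undefined\<close>,
        because homomorphisms are extensional.\<close>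
      have "k \<in> carrier S \<rightarrow>\<^sub>E carrier T" using k by (simp add: quandle_hom_def)
      then have "k a = undefined" using False by (rule PiE_arb)
      then show ?thesis using False by (simp add: Hom_def)
    qed
  qed
  ultimately show ?thesis by blast
qed

theorem lemma3p6:
  fixes S :: "('a, 'm) quandle_struct_scheme"
    and T :: "('b, 'n) quandle_struct_scheme"
  assumes "medial_quandle T"
    and "finite (carrier T)"
    and "connected_quandle T"
    and "quandle S"
  shows "connected_quandle (Hom S T)"
proof (rule quandle.left_transitive_imp_connected[OF quandle_Hom[OF assms(4,1)]])
  interpret S: quandle S by (rule assms)
  interpret T: medial_quandle T by (rule assms)
  \<comment> \<open>Having exactly one component forces \<open>T\<close> to be nonempty; by
    idempotence a constant map is then a homomorphism, so \<open>Hom S T\<close> is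
    nonempty.\<close>
  obtain e where e: "e \<in> carrier T"
    using assms(3) by (auto simp: connected_quandle_def components_def orbits_def)
  then have "(\<lambda>a\<in>carrier S. e) \<in> quandle_hom S T"
    by (auto simp: quandle_hom_def T.idem)
  then show "carrier (Hom S T) \<noteq> {}" by (auto simp: Hom_def)
  show "\<exists>f\<in>carrier (Hom S T). f \<triangleright>\<^bsub>Hom S T\<^esub> h = k"
    if "h \<in> carrier (Hom S T)" "k \<in> carrier (Hom S T)" for h k
    using Hom_right_div[OF assms(4,1) T.finite_connected_imp_latin[OF assms(2,3)]] that
    by (simp add: Hom_def)
qed

end
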